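(* Let $\Lambda$ be a $\sigma$-compact metric space, $\sigma$ a positive diffuse Radon measure on $\Lambda$, and $\mu_\sigma$ the Poisson measure of intensity $\sigma$ on $\Gamma_\Lambda$. For any compact set $K\subset\Lambda$ and any $r>0$, $$\mu_\sigma\big(\omega(K)\ge\sigma(K)+r\big)\le\frac{[\sigma(K)+r]}{r}\;\frac{\exp\left\{[\sigma(K)+r]-\sigma(K)-[\sigma(K)+r]\log\left(\frac{[\sigma(K)+r]}{\sigma(K)}\right)\right\}}{\sqrt{2\pi[\sigma(K)+r]}}.$$
   Context: For a positive real number $R$, $[R]=\inf\{N\in\{1,2,3,\dots\}:N\ge R\}$ denotes the upper integer part. If $\sigma(K)=0$ the right-hand side is interpreted as $0$. $\Gamma_\Lambda=\{\omega\subset\Lambda : \omega\cap K \text{ is finite for every compact } K\}$ is the configuration space, with $\omega$ identified with the Radon measure $\sum_{x\in\omega}\varepsilon_x$ (sum of Dirac masses), so that $\omega(K)$ is the number of points of $\omega$ in $K$. It carries the vague topology and its Borel $\sigma$-algebra. The Poisson measure $\mu_\sigma$ is characterized by $\mathbb{E}_{\mu_\sigma}[\exp(\int_\Lambda f\,d\omega)]=\exp\{\int_\Lambda(e^f-1)\,d\sigma\}$ for all continuous compactly supported $f$. *)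

theory Defs
  imports "HOL-Probability.Probability"
begin

definition sigma_compact :: "'a::topological_space set \<Rightarrow> bool" where
  "sigma_compact S \<longleftrightarrow> (\<exists>C. countable C \<and> (\<forall>K\<in>C. compact K) \<and> \<Union>C = S)"

text \<open>Local finiteness and outer regularity are not listed: on a \<open>\<sigma>\<close>-compact metric space
  they follow from the two conditions below.\<close>

definition radon_measure :: "'a::metric_space measure \<Rightarrow> bool" where
  "radon_measure \<sigma> \<longleftrightarrow>
     sets \<sigma> = sets borel \<and>
     (\<forall>K. compact K \<longrightarrow> emeasure \<sigma> K < \<infinity>) \<and>
     (\<forall>A\<in>sets borel. emeasure \<sigma> A = (SUP K\<in>{K. compact K \<and> K \<subseteq> A}. emeasure \<sigma> K))"

definition diffuse_measure :: "'a::metric_space measure \<Rightarrow> bool" where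
  "diffuse_measure \<sigma> \<longleftrightarrow> (\<forall>x. emeasure \<sigma> {x} = 0)"

definition Cc :: "('a::metric_space \<Rightarrow> real) set" where
  "Cc = {f. continuous_on UNIV f \<and> compact (closure {x. f x \<noteq> 0})}"

definition configurations :: "'a::metric_space set set" where
  "configurations = {\<omega>. \<forall>K. compact K \<longrightarrow> finite (\<omega> \<inter> K)}"

text \<open>The sum of the Dirac masses at the points of \<open>\<omega>\<close>, as a Borel measure: its value on a
  Borel set \<open>A\<close> is the number of points of \<open>\<omega> \<inter> A\<close>.\<close>

definition config_measure :: "'a::metric_space set \<Rightarrow> 'a measure" where
  "config_measure \<omega> = distr (count_space \<omega>) borel (\<lambda>x. x)"

text \<open>The vague topology is the coarsest one making \<open>\<omega> \<mapsto> \<integral> f d\<omega>\<close> continuous for all \<open>f \<in> Cc\<close>.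
  Local compactness of the base space is not assumed. A point without compact neighbourhood is a
  zero of every \<open>f \<in> Cc\<close>, so counting events on a compact set containing such a
  point need not be Borel; \<open>measure\<close> gives non-measurable sets the value 0.\<close>

definition vague_topology :: "'a::metric_space set topology" where
  "vague_topology = topology_generated_by
     {{\<omega> \<in> configurations. (\<integral>x. f x \<partial>config_measure \<omega>) \<in> U} | f U. f \<in> Cc \<and> open (U :: real set)}"

definition configuration_space :: "'a::metric_space set measure" where
  "configuration_space = sigma configurations {U. openin vague_topology U}"

definition poisson_measure :: "'a::metric_space measure \<Rightarrow> 'a set measure \<Rightarrow> bool" where
  "poisson_measure \<sigma> \<mu> \<longleftrightarrow>
     prob_space \<mu> \<and>
     space \<mu> = configurations \<and>
     sets \<mu> = sets configuration_space \<and>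
     (\<forall>f\<in>Cc. has_bochner_integral \<mu> (\<lambda>\<omega>. exp (\<integral>x. f x \<partial>config_measure \<omega>))
                (exp (\<integral>x. (exp (f x) - 1) \<partial>\<sigma>)))"

definition upper_int :: "real \<Rightarrow> nat" where
  "upper_int R = Inf {N. N \<ge> 1 \<and> real N \<ge> R}"

definition poisson_tail_bound :: "real \<Rightarrow> real \<Rightarrow> real" where
  "poisson_tail_bound s r =
     (if s = 0 then 0
      else let n = real (upper_int (s + r)) in
        n / r * (exp (n - s - n * ln (n / s)) / sqrt (2 * pi * n)))"

lemma sets_config_measure [simp]: "sets (config_measure \<omega>) = sets borel"
  by (simp add: config_measure_def)

lemma emeasure_config_measure:
  assumes "A \<in> sets borel"
  shows "emeasure (config_measure \<omega>) A = emeasure (count_space \<omega>) (\<omega> \<inter> A)"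
  using assms by (simp add: config_measure_def emeasure_distr Int_commute)

lemma measure_config_measure_compact:
  assumes "\<omega> \<in> configurations" "compact K"
  shows "measure (config_measure \<omega>) K = real (card (\<omega> \<inter> K))"
  using assms by (simp add: measure_def emeasure_config_measure borel_compact configurations_def)

lemma topspace_vague_topology: "topspace vague_topology = configurations"
proof -
  have "(\<lambda>_. 0) \<in> (Cc :: ('a \<Rightarrow> real) set)" by (simp add: Cc_def)
  then have "configurations \<in> {{\<omega> \<in> (configurations :: 'a set set).
      (\<integral>x. f x \<partial>config_measure \<omega>) \<in> U} | f U. f \<in> Cc \<and> open (U :: real set)}"
    by (intro CollectI exI[of _ "\<lambda>_. 0"] exI[of _ UNIV]) auto
  then show ?thesis
    unfolding vague_topology_def topology_generated_by_topspace by blast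
qed

end

theory Submission
  imports Defs
begin

text \<open>The number of points of a Poisson configuration in \<open>K\<close> has the Poisson law with mean
  \<open>s = \<sigma>(K)\<close>, and the inequality is an estimate of the tail of that law. If \<open>n\<close> is the upper
  integer part of \<open>s + r\<close>, the event says that there are at least \<open>n\<close> points in \<open>K\<close>. Comparing the tail
  of the Poisson series with a geometric series bounds it by \<open>n / r\<close> times its first term
  \<open>exp (-s) * s ^ n / n!\<close>, and Stirling's lower bound for \<open>n!\<close> turns this into the stated expression
  (\<open>poisson_tail_sum_le\<close>). Stirling's bound with the sharp constant is derived from Wallis'
  product (\<open>stirling_lower_bound\<close>).

  The law of the number of points is found by approximating the indicator of \<open>K\<close> by continuous
  compactly supported functions, which determines the Laplace transform of the count on the negative
  half-line (\<open>poisson_measure_count\<close>), and hence its probability generating function on the unit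
  interval; uniqueness of power series coefficients does the rest
  (\<open>poisson_distribution_of_laplace\<close>).

  Such an approximation exists only if every point of \<open>K\<close> has a compact neighbourhood. If some
  point has none, the vague topology does not see whether a configuration contains that point. The
  counting event, unless it is empty, does depend on it, so it is not measurable and \<open>measure\<close>
  assigns it the value 0 (\<open>counting_event_not_measurable\<close>).\<close>

section \<open>Stirling's lower bound for the factorial\<close>

text \<open>Wallis' partial products \<open>W n\<close> increase to \<open>pi / 2\<close>, but \<open>W n * (1 + 1 / (2 * n))\<close> decreases to
  the same limit. The central binomial coefficient satisfies \<open>(2n choose n)^2 * (2n + 1) * W n = 16^n\<close>,
  so bounding the decreasing sequence below by its limit gives the sharp constant.\<close>

lemma central_binomial_upper_bound:
  assumes "n > 0"
  shows "real n * pi * real ((2 * n) choose n) ^ 2 \<le> 16 ^ n"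
proof -
  define W where "W = (\<lambda>n. \<Prod>k=1..n. (4 * real k ^ 2) / (4 * real k ^ 2 - 1))"
  \<comment> \<open>The index is shifted by one to keep clear of the division by zero at \<open>n = 0\<close>.\<close>
  define V where "V = (\<lambda>n. W (Suc n) * (1 + 1 / (2 * real (Suc n))))"
  have W_Suc: "W (Suc m) = W m * (4 * real (Suc m) ^ 2 / ((2 * real m + 1) * (2 * real m + 3)))" for m
    by (simp add: W_def power2_eq_square algebra_simps)
  have W_pos: "W m > 0" for m
  proof (induction m)
    case (Suc m)
    then show ?case unfolding W_Suc by (intro mult_pos_pos divide_pos_pos) auto
  qed (simp add: W_def)
  have "V (Suc m) \<le> V m" for m
  proof -
    define x where "x = real m"
    have x: "x \<ge> 0" by (simp add: x_def)
    have "V (Suc m) = W (Suc m) * (4 * (x+2)^2 / ((2*x+3) * (2*x+5)) * ((2*x+5) / (2*x+4)))"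
    proof -
      have "1 + 1 / (2 * real (Suc (Suc m))) = (2*x+5) / (2*x+4)"
        by (simp add: x_def divide_simps) (simp add: algebra_simps)
      moreover have "W (Suc (Suc m)) = W (Suc m) * (4 * (x+2)^2 / ((2*x+3) * (2*x+5)))"
        by (simp add: W_Suc[of "Suc m"] x_def algebra_simps)
      ultimately show ?thesis unfolding V_def by simp
    qed
    also have "\<dots> \<le> W (Suc m) * ((2*x+3) / (2*x+2))"
    proof (intro mult_left_mono)
      have "4 * (x+2)^2 / ((2*x+3) * (2*x+5)) * ((2*x+5) / (2*x+4)) = (2*x+4) / (2*x+3)"
        using x by (simp add: divide_simps) (auto simp: power2_eq_square algebra_simps)
      also have "\<dots> \<le> (2*x+3) / (2*x+2)"
        using x by (simp add: divide_simps) (simp add: algebra_simps)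
      finally show "4 * (x+2)^2 / ((2*x+3) * (2*x+5)) * ((2*x+5) / (2*x+4)) \<le> (2*x+3) / (2*x+2)" .
    qed (use W_pos[of "Suc m"] in simp)
    also have "\<dots> = V m"
      using x by (simp add: V_def x_def field_simps)
    finally show ?thesis .
  qed
  then have "decseq V" by (simp add: decseq_Suc_iff)
  moreover have "V \<longlonglongrightarrow> pi / 2"
  proof -
    have "W \<longlonglongrightarrow> pi / 2" unfolding W_def by (rule wallis)
    then have "(\<lambda>n. W (Suc n)) \<longlonglongrightarrow> pi / 2" by (rule LIMSEQ_Suc)
    moreover have "(\<lambda>n. 1 + 1 / (2 * real (Suc n))) \<longlonglongrightarrow> 1" by real_asymp
    ultimately show ?thesis unfolding V_def using tendsto_mult by fastforce
  qed
  ultimately have V_ge: "V m \<ge> pi / 2" for m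
    using decseq_ge by blast
  define C where "C = (\<lambda>m. real ((2 * m) choose m))"
  have C_Suc: "C (Suc m) = 2 * (2 * real m + 1) / (real m + 1) * C m" for m
  proof -
    have "C (Suc m) = fact (2 * Suc m) / (fact (Suc m) * fact (Suc m))"
      unfolding C_def by (subst binomial_fact) simp_all
    also have "\<dots> = 2 * (2 * real m + 1) / (real m + 1) * (fact (2 * m) / (fact m * fact m))"
      by (simp add: divide_simps) (simp add: algebra_simps)
    also have "fact (2 * m) / (fact m * fact m) = C m"
      by (simp add: C_def binomial_fact)
    finally show ?thesis .
  qed
  have binom: "C m ^ 2 * ((2 * real m + 1) * W m) = 16 ^ m" for m
  proof (induction m)
    case (Suc m)
    have "C (Suc m) ^ 2 * ((2 * real (Suc m) + 1) * W (Suc m))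
        = (2 * (2 * real m + 1) / (real m + 1) * C m) ^ 2 *
          ((2 * real m + 3) * (W m * (4 * (real m + 1) ^ 2 / ((2 * real m + 1) * (2 * real m + 3)))))"
      unfolding W_Suc C_Suc by (simp add: add.commute)
    also have "\<dots> = 16 * (C m ^ 2 * ((2 * real m + 1) * W m))"
      by (simp add: divide_simps power2_eq_square) (simp add: algebra_simps)
    finally show ?case using Suc by simp
  qed (simp add: W_def C_def)
  from assms obtain m where m: "n = Suc m" by (cases n) auto
  have "2 * real n * (pi / 2) \<le> 2 * real n * V m"
    using V_ge[of m] by (intro mult_left_mono) auto
  also have "\<dots> = (2 * real n + 1) * W n"
    by (simp add: V_def m field_simps)
  finally have "C n ^ 2 * (real n * pi) \<le> C n ^ 2 * ((2 * real n + 1) * W n)"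
    by (intro mult_left_mono) auto
  then show ?thesis unfolding binom by (simp add: C_def mult_ac)
qed

lemma power_le_fact_exp: "real n ^ n \<le> fact n * exp (real n)"
proof -
  have "(\<lambda>k. real n ^ k / fact k) sums exp (real n)"
    using exp_converges[of "real n"] by (simp add: divide_inverse mult.commute)
  then have "(\<Sum>k\<in>{n}. real n ^ k / fact k) \<le> exp (real n)"
    using sum_le_suminf[of "\<lambda>k. real n ^ k / fact k" "{n}"] by (simp add: sums_iff)
  then show ?thesis by (simp add: field_simps)
qed

text \<open>Let \<open>b n\<close> be the square of the quotient of \<open>n!\<close> by the claimed lower bound. The central binomial
  estimate says exactly that \<open>b (2 * n) \<le> b n ^ 2\<close>. If \<open>b n < 1\<close> held for some \<open>n\<close>, iterating
  would make \<open>b (2 ^ k * n)\<close> decay like \<open>b n ^ (2 ^ k)\<close>, that is, exponentially in the argument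
  \<open>2 ^ k * n\<close>; but the crude estimate \<open>m! \<ge> (m / e) ^ m\<close> shows that \<open>b m\<close> decays
  at most like \<open>1 / m\<close>. This yields the constant \<open>2 * pi\<close> without any convergence
  statement about \<open>b\<close>.\<close>

lemma stirling_lower_bound:
  assumes "n > 0"
  shows "sqrt (2 * pi * real n) * (real n / exp 1) ^ n \<le> fact n"
proof -
  define b where "b = (\<lambda>n. fact n ^ 2 * exp 1 ^ (2 * n) / (2 * pi * real n * real n ^ (2 * n)))"
  have b_nonneg: "b m \<ge> 0" for m
    by (simp add: b_def)
  have b_double: "b (2 * m) \<le> b m ^ 2" if "m > 0" for m
  proof -
    have m: "real m > 0" using that by simp
    have "fact (2 * m) = fact m * fact m * real ((2 * m) choose m)"
      using binomial_fact_lemma[of m "2 * m"]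
      by (metis (no_types, lifting) add_diff_cancel_right' le_add2 mult_2 of_nat_fact of_nat_mult)
    moreover have sixteen: "16 ^ m = (2 ^ m * (2 ^ m * (2 ^ m * 2 ^ m)) :: real)"
      by (simp flip: power_mult_distrib)
    ultimately have "b (2 * m) = real m * pi * real ((2 * m) choose m) ^ 2 / 16 ^ m * b m ^ 2"
      using m by (simp add: b_def power_mult_distrib power_mult field_simps power2_eq_square sixteen)
    also have "\<dots> \<le> 1 * b m ^ 2"
      using central_binomial_upper_bound[OF that] by (intro mult_right_mono) auto
    finally show ?thesis by simp
  qed
  have b_iterate: "b (2 ^ k * n) \<le> b n ^ (2 ^ k)" for k
  proof (induction k)
    case (Suc k)
    have "b (2 ^ Suc k * n) \<le> b (2 ^ k * n) ^ 2"
      using b_double[of "2 ^ k * n"] assms by (simp add: mult.assoc)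
    also have "\<dots> \<le> (b n ^ (2 ^ k)) ^ 2"
      using Suc b_nonneg by (intro power_mono) auto
    finally show ?case by (simp add: power_mult[symmetric] mult.commute)
  qed simp
  have b_lower: "1 / (2 * pi * real m) \<le> b m" if "m > 0" for m
  proof -
    have "(real m ^ m) ^ 2 \<le> (fact m * exp (real m)) ^ 2"
      by (intro power_mono power_le_fact_exp) auto
    also have "\<dots> = fact m ^ 2 * exp 1 ^ (2 * m)"
      by (simp add: power_mult_distrib power_mult exp_of_nat_mult[symmetric] power2_eq_square
            flip: exp_add exp_of_nat_mult)
    finally have "real m ^ (2 * m) \<le> fact m ^ 2 * exp 1 ^ (2 * m)"
      by (simp add: power_mult[symmetric] mult.commute)
    then show ?thesis
      using that unfolding b_def by (simp add: divide_simps mult_ac)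
  qed
  have "1 \<le> b n"
  proof (rule ccontr)
    assume "\<not> 1 \<le> b n"
    then have "norm (b n) < 1" using b_nonneg[of n] by simp
    then have "(\<lambda>j. 2 * pi * real n * (real j * b n ^ j)) \<longlonglongrightarrow> 2 * pi * real n * 0"
      by (intro tendsto_mult tendsto_const powser_times_n_limit_0)
    moreover have "filterlim (\<lambda>k. 2 ^ k :: nat) at_top sequentially"
      by (rule filterlim_subseq) (simp add: strict_mono_def)
    ultimately have "(\<lambda>k. 2 * pi * real n * (real (2 ^ k) * b n ^ (2 ^ k))) \<longlonglongrightarrow> 0"
      using filterlim_compose[of "\<lambda>j. 2 * pi * real n * (real j * b n ^ j)" "nhds 0" sequentially "\<lambda>k. 2 ^ k"]
      by simp
    then have "\<forall>\<^sub>F k in sequentially. 2 * pi * real n * (real (2 ^ k) * b n ^ (2 ^ k)) < 1"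
      by (rule order_tendstoD) simp
    then obtain k where k: "2 * pi * real n * (real (2 ^ k) * b n ^ (2 ^ k)) < 1"
      by (meson eventually_happens sequentially_bot)
    have "1 / (2 * pi * real (2 ^ k * n)) \<le> b n ^ (2 ^ k)"
      using b_lower[of "2 ^ k * n"] b_iterate[of k] assms by simp
    then have "1 \<le> 2 * pi * real n * (real (2 ^ k) * b n ^ (2 ^ k))"
      using assms by (simp add: divide_simps mult_ac)
    with k show False by simp
  qed
  then have "2 * pi * real n * real n ^ (2 * n) \<le> fact n ^ 2 * exp 1 ^ (2 * n)"
    using assms by (simp add: b_def divide_simps)
  then have "(sqrt (2 * pi * real n) * (real n / exp 1) ^ n) ^ 2 \<le> fact n ^ 2"
    by (simp add: power_mult_distrib power_divide divide_simps power_mult[symmetric] mult.commute)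
  then show ?thesis
    by (rule power2_le_imp_le) simp
qed

section \<open>The tail of the Poisson distribution\<close>

lemma power_mult_fact_le_fact_add: "real n ^ i * fact n \<le> fact (n + i)"
proof (induction i)
  case (Suc i)
  have "real n ^ Suc i * fact n \<le> real (n + Suc i) * (real n ^ i * fact n)"
    by (simp add: algebra_simps)
  also have "\<dots> \<le> real (n + Suc i) * fact (n + i)"
    using Suc by (intro mult_left_mono) auto
  finally show ?case by simp
qed simp

text \<open>Beyond the index \<open>n\<close> each term of the Poisson law is at most \<open>s / n\<close> times its predecessor, so the
  tail is at most its first term times \<open>1 / (1 - s / n) = n / (n - s) \<le> n / r\<close>. The exponential
  factor of the bound is the first term after Stirling's estimate of \<open>n!\<close>.\<close>

lemma poisson_tail_sum_le:
  fixes s r T :: real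
  assumes s: "s > 0" and r: "r > 0" and n: "s + r \<le> real n"
    and sums: "(\<lambda>j. s ^ j / fact j * exp (-s) * of_bool (n \<le> j)) sums T"
  shows "T \<le> real n / r * (exp (n - s - n * ln (n / s)) / sqrt (2 * pi * n))"
proof -
  have n0: "real n > 0" "n > 0" using s r n by auto
  define q where "q = s / real n"
  have q: "0 \<le> q" "q < 1" using s r n n0 by (auto simp: q_def)
  define c where "c = s ^ n / fact n * exp (-s)"
  have c: "c \<ge> 0" using s by (simp add: c_def)
  have shifted: "(\<lambda>i. s ^ (i + n) / fact (i + n) * exp (-s)) sums T"
    using sums sums_iff_shift[of "\<lambda>j. s ^ j / fact j * exp (-s) * of_bool (n \<le> j)" n T] by simp
  have geometric: "(\<lambda>i. c * q ^ i) sums (c * (1 / (1 - q)))"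
    using q by (intro sums_mult geometric_sums) auto
  have "T \<le> c * (1 / (1 - q))"
  proof (rule sums_le[OF _ shifted geometric])
    fix i
    have "s ^ (i + n) / fact (i + n) \<le> s ^ (i + n) / (real n ^ i * fact n)"
      using power_mult_fact_le_fact_add[of n i] n0 s
      by (intro divide_left_mono) (auto simp: add.commute)
    also have "\<dots> = s ^ n / fact n * q ^ i"
      by (simp add: q_def power_add power_divide mult.commute)
    finally have "s ^ (i + n) / fact (i + n) * exp (-s) \<le> s ^ n / fact n * q ^ i * exp (-s)"
      by (rule mult_right_mono) simp
    then show "s ^ (i + n) / fact (i + n) * exp (-s) \<le> c * q ^ i"
      by (simp add: c_def mult_ac)
  qed
  also have "1 / (1 - q) = real n / (real n - s)"
    using n0 by (simp add: q_def field_simps)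
  also have "c * (real n / (real n - s)) \<le> c * (real n / r)"
    using c n r n0 by (intro mult_left_mono divide_left_mono) (auto intro: mult_pos_pos)
  also have "c * (real n / r) \<le> exp (n - s - n * ln (n / s)) / sqrt (2 * pi * n) * (real n / r)"
  proof (intro mult_right_mono)
    show "c \<le> exp (n - s - n * ln (n / s)) / sqrt (2 * pi * n)"
    proof -
      have "c \<le> s ^ n / (sqrt (2 * pi * n) * (real n / exp 1) ^ n) * exp (-s)"
        unfolding c_def using stirling_lower_bound[OF n0(2)] s n0
        by (intro mult_right_mono divide_left_mono) (auto intro!: mult_pos_pos)
      also have "\<dots> = (exp (-s) * (exp 1 ^ n / (real n / s) ^ n)) / sqrt (2 * pi * n)"
        using s n0 by (simp add: power_divide mult.commute)
      also have "exp (-s) * (exp 1 ^ n / (real n / s) ^ n) = exp (n - s - n * ln (n / s))"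
      proof -
        have "(real n / s) ^ n = exp (n * ln (n / s))"
          using s n0 by (simp add: exp_of_nat_mult)
        moreover have "exp 1 ^ n = exp (real n)"
          by (simp flip: exp_of_nat_mult)
        ultimately show ?thesis by (simp add: exp_diff exp_minus exp_add field_simps)
      qed
      finally show ?thesis .
    qed
  qed (use r in simp)
  finally show ?thesis
    using r by (simp add: mult.commute)
qed

section \<open>Discrete distributions and their generating functions\<close>

text \<open>The hypothesis concerns one side of the origin only: the generating function of a law is known through
  its Laplace transform, on \<open>0 < z < 1\<close>. Continuity of the power series at the origin suffices.\<close>

lemma power_series_zero_const_coeff:
  fixes a :: "nat \<Rightarrow> real"
  assumes zero: "\<And>z. 0 < z \<Longrightarrow> z < 1 \<Longrightarrow> (\<lambda>n. a n * z ^ n) sums 0"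
  shows "a 0 = 0"
proof -
  have summable: "summable (\<lambda>n. a n * (1/2) ^ n)"
    using zero[of "1/2"] by (auto simp: sums_iff)
  then have "((\<lambda>x. \<Sum>n. a n * x ^ n) \<longlongrightarrow> (\<Sum>n. a n * 0 ^ n)) (at 0)"
    using isCont_powser[of a "1/2" 0] by (simp add: isCont_def)
  then have lim: "((\<lambda>x. \<Sum>n. a n * x ^ n) \<longlongrightarrow> a 0) (at_right 0)"
    by (auto intro: tendsto_within_subset)
  have "\<forall>\<^sub>F x in at_right (0::real). (\<Sum>n. a n * x ^ n) = 0"
    by (subst eventually_at_right[of 0 1]) (auto intro!: exI[of _ 1] sums_unique[symmetric] zero)
  then have "((\<lambda>x. \<Sum>n. a n * x ^ n) \<longlongrightarrow> 0) (at_right 0)"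
    by (rule tendsto_eventually)
  with lim show ?thesis
    using tendsto_unique[of "at_right (0::real)"] by force
qed

lemma power_series_zero_coeffs:
  fixes a :: "nat \<Rightarrow> real"
  assumes "\<And>z. 0 < z \<Longrightarrow> z < 1 \<Longrightarrow> (\<lambda>n. a n * z ^ n) sums 0"
  shows "a n = 0"
  using assms
proof (induction n arbitrary: a)
  case (0 a)
  then show ?case by (rule power_series_zero_const_coeff)
next
  case (Suc n a)
  have a0: "a 0 = 0"
    using Suc.prems by (rule power_series_zero_const_coeff)
  show ?case
  proof (rule Suc.IH)
    fix z :: real assume z: "0 < z" "z < 1"
    have "(\<lambda>n. a (Suc n) * z ^ Suc n) sums 0"
      using Suc.prems[OF z] a0 by (subst sums_Suc_iff) simp
    then have "(\<lambda>n. a (Suc n) * z ^ Suc n / z) sums (0 / z)"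
      by (rule sums_divide)
    then show "(\<lambda>n. a (Suc n) * z ^ n) sums 0"
      using z by simp
  qed
qed

lemma (in prob_space) expectation_nat_sums:
  fixes N :: "'a \<Rightarrow> nat" and f :: "nat \<Rightarrow> real"
  assumes N [measurable]: "N \<in> measurable M (count_space UNIV)"
    and bounded: "\<And>j. \<bar>f j\<bar> \<le> B"
  shows "(\<lambda>j. prob {x \<in> space M. N x = j} * f j) sums expectation (\<lambda>x. f (N x))"
proof -
  define p where "p = (\<lambda>j. prob {x \<in> space M. N x = j})"
  have p: "p j \<ge> 0" for j by (simp add: p_def)
  have distr: "distr M (count_space UNIV) N = density (count_space UNIV) (\<lambda>j. ennreal (p j))"
  proof (rule measure_eqI_countable[of _ UNIV])
    fix j :: nat
    have "emeasure (distr M (count_space UNIV) N) {j} = emeasure M (N -` {j} \<inter> space M)"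
      by (rule emeasure_distr) auto
    also have "N -` {j} \<inter> space M = {x \<in> space M. N x = j}" by auto
    finally show "emeasure (distr M (count_space UNIV) N) {j}
        = emeasure (density (count_space UNIV) (\<lambda>j. ennreal (p j))) {j}"
      by (simp add: p_def emeasure_density emeasure_eq_measure nn_integral_count_space_indicator[symmetric]
          nn_integral_count_space_finite)
  qed auto
  have "integrable M (\<lambda>x. f (N x))"
    by (rule integrable_const_bound[of _ B]) (auto simp: bounded)
  then have "integrable (distr M (count_space UNIV) N) f"
    by (subst integrable_distr_eq) auto
  then have "integrable (count_space UNIV) (\<lambda>j. p j *\<^sub>R f j)"
    unfolding distr using p by (subst (asm) integrable_density) auto
  then have "(\<lambda>j. p j *\<^sub>R f j) sums (\<integral>j. p j *\<^sub>R f j \<partial>count_space UNIV)"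
    by (rule sums_integral_count_space_nat)
  also have "(\<integral>j. p j *\<^sub>R f j \<partial>count_space UNIV) = integral\<^sup>L (distr M (count_space UNIV) N) f"
    unfolding distr using p by (subst integral_density) auto
  also have "\<dots> = expectation (\<lambda>x. f (N x))"
    by (rule integral_distr) auto
  finally show ?thesis by (simp add: p_def)
qed

text \<open>With \<open>z = exp t\<close> the hypothesis is that \<open>N\<close> has the probability generating function of a Poisson
  law on \<open>0 < z < 1\<close>, and power series coefficients are unique.\<close>

lemma (in prob_space) poisson_distribution_of_laplace:
  fixes N :: "'a \<Rightarrow> nat"
  assumes N [measurable]: "N \<in> measurable M (count_space UNIV)"
    and laplace: "\<And>t. t < 0 \<Longrightarrow> expectation (\<lambda>x. exp (t * real (N x))) = exp ((exp t - 1) * s)"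
  shows "prob {x \<in> space M. N x = j} = s ^ j / fact j * exp (-s)"
proof -
  define a where "a = (\<lambda>j. prob {x \<in> space M. N x = j} - s ^ j / fact j * exp (-s))"
  have "a j = 0"
  proof (rule power_series_zero_coeffs)
    fix z :: real assume z: "0 < z" "z < 1"
    define t where "t = ln z"
    have t: "t < 0" "exp t = z" using z by (auto simp: t_def)
    have pow: "exp (t * real k) = z ^ k" for k
      using t(2) by (metis exp_of_nat_mult mult.commute)
    have "(\<lambda>j. prob {x \<in> space M. N x = j} * z ^ j) sums expectation (\<lambda>x. z ^ N x)"
      using z by (intro expectation_nat_sums[where B = 1] N) (simp add: power_le_one)
    also have "expectation (\<lambda>x. z ^ N x) = exp ((z - 1) * s)"
      using laplace[OF t(1)] by (simp add: pow t(2))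
    finally have 1: "(\<lambda>j. prob {x \<in> space M. N x = j} * z ^ j) sums exp ((z - 1) * s)" .
    have "(\<lambda>j. (z * s) ^ j / fact j * exp (-s)) sums (exp (z * s) * exp (-s))"
      using exp_converges[of "z * s"] by (intro sums_mult2) (simp add: divide_inverse mult.commute)
    also have "exp (z * s) * exp (-s) = exp ((z - 1) * s)"
      by (simp add: algebra_simps flip: exp_add)
    finally have 2: "(\<lambda>j. (z * s) ^ j / fact j * exp (-s)) sums exp ((z - 1) * s)" .
    show "(\<lambda>j. a j * z ^ j) sums 0"
      using sums_diff[OF 1 2] by (simp add: a_def algebra_simps power_mult_distrib)
  qed
  then show ?thesis by (simp add: a_def)
qed

section \<open>What the vague topology sees of a configuration\<close>

lemma integral_config_measure:
  fixes f :: "'a::metric_space \<Rightarrow> real"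
  assumes f: "continuous_on UNIV f" and V: "compact V" "{x. f x \<noteq> 0} \<subseteq> V"
    and \<omega>: "\<omega> \<in> configurations"
  shows "(\<integral>x. f x \<partial>config_measure \<omega>) = (\<Sum>x\<in>\<omega> \<inter> V. f x)"
proof -
  have fin: "finite (\<omega> \<inter> V)" using V(1) \<omega> by (simp add: configurations_def)
  have "(\<integral>x. f x \<partial>config_measure \<omega>) = (\<integral>x. f x \<partial>count_space \<omega>)"
    unfolding config_measure_def
    using borel_measurable_continuous_onI[OF f] by (intro integral_distr) auto
  also have "\<dots> = (\<Sum>x\<in>{x\<in>\<omega>. f x \<noteq> 0}. f x)"
    using fin V(2) by (intro lebesgue_integral_count_space_finite_support) (auto elim!: finite_subset[rotated])
  also have "\<dots> = (\<Sum>x\<in>\<omega> \<inter> V. f x)"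
    using fin V(2) by (intro sum.mono_neutral_left) auto
  finally show ?thesis .
qed

text \<open>The open set where \<open>f\<close> does not vanish lies in the interior of the compact support of \<open>f\<close>.\<close>

lemma Cc_vanishes:
  fixes f :: "'a::metric_space \<Rightarrow> real"
  assumes f: "f \<in> Cc" and p: "\<nexists>V. compact V \<and> p \<in> interior V"
  shows "f p = 0"
proof (rule ccontr)
  assume "f p \<noteq> 0"
  have "open (f -` (- {0}))"
    using f by (intro open_vimage) (auto simp: Cc_def)
  also have "f -` (- {0}) = {x. f x \<noteq> 0}" by auto
  finally have "{x. f x \<noteq> 0} \<subseteq> interior (closure {x. f x \<noteq> 0})"
    by (rule interior_maximal[rotated]) (rule closure_subset)
  with \<open>f p \<noteq> 0\<close> p f show False by (auto simp: Cc_def)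
qed

lemma sets_configuration_space:
  "sets (configuration_space :: 'a::metric_space set measure)
     = sigma_sets configurations {U. openin vague_topology U}"
proof -
  have "{U. openin vague_topology U} \<subseteq> Pow (configurations :: 'a set set)"
    using openin_subset topspace_vague_topology by blast
  then show ?thesis
    unfolding configuration_space_def by (rule sets_measure_of)
qed

text \<open>Two configurations with the same integrals against all test functions lie in the same subbasic sets, and
  this property passes to the generated topology and then to its \<open>\<sigma>\<close>-algebra.\<close>

lemma sets_configuration_space_saturated:
  assumes A: "A \<in> sets configuration_space"
    and \<omega>: "\<omega> \<in> configurations" "\<omega>' \<in> configurations"
    and same: "\<And>f. f \<in> Cc \<Longrightarrow> (\<integral>x. f x \<partial>config_measure \<omega>) = (\<integral>x. f x \<partial>config_measure \<omega>')"
  shows "\<omega> \<in> A \<longleftrightarrow> \<omega>' \<in> A"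
proof -
  have opens: "\<omega> \<in> U \<longleftrightarrow> \<omega>' \<in> U" if "openin vague_topology U" for U
  proof -
    from that have "generate_topology_on
       {{\<omega> \<in> configurations. (\<integral>x. f x \<partial>config_measure \<omega>) \<in> U} | f U. f \<in> Cc \<and> open (U :: real set)} U"
      unfolding vague_topology_def by (rule openin_topology_generated_by)
    then show ?thesis
    proof induction
      case (Basis s)
      then show ?case using \<omega> same by auto
    qed auto
  qed
  have "A \<in> sigma_sets configurations {U. openin vague_topology U}"
    using A by (simp add: sets_configuration_space)
  then show ?thesis
  proof induction
    case (Basic a)
    then show ?case using opens by simp
  next
    case (Compl a)
    then show ?case using \<omega> by simp
  qed auto
qed

lemma finite_in_configurations: "finite F \<Longrightarrow> F \<in> configurations"
  by (simp add: configurations_def)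

text \<open>If \<open>p \<in> K\<close> has no compact neighbourhood, test functions vanish at \<open>p\<close>, hence a measurable event
  cannot tell whether \<open>p\<close> belongs to the configuration. The event of having at least \<open>R\<close> points in
  \<open>K\<close> can: if it is nonempty, \<open>K\<close> contains a finite set that misses \<open>p\<close> and is exactly one point
  short of the threshold.\<close>

lemma counting_event_not_measurable:
  fixes K :: "'a::metric_space set"
  assumes K: "compact K" and p: "p \<in> K" "\<nexists>V. compact V \<and> p \<in> interior V"
    and R: "R > 0"
    and meas: "{\<omega> \<in> configurations. real (card (\<omega> \<inter> K)) \<ge> R} \<in> sets configuration_space"
  shows "{\<omega> \<in> configurations. real (card (\<omega> \<inter> K)) \<ge> R} = {}"
proof (rule ccontr)
  let ?E = "{\<omega> \<in> configurations. real (card (\<omega> \<inter> K)) \<ge> R}"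
  assume "?E \<noteq> {}"
  then obtain \<omega> where \<omega>: "\<omega> \<in> configurations" "real (card (\<omega> \<inter> K)) \<ge> R" by auto
  \<comment> \<open>The threshold in whole points: \<open>n - 1\<close> points fall short of \<open>R\<close>, and \<open>n\<close> reach it.\<close>
  define n where "n = nat \<lceil>R\<rceil>"
  have n: "n > 0" "real n \<ge> R" "real (n - 1) < R" "n \<le> card (\<omega> \<inter> K)"
    using R \<omega>(2) unfolding n_def by linarith+
  have "finite (\<omega> \<inter> K)" using \<omega>(1) K by (simp add: configurations_def)
  then have "card (\<omega> \<inter> K) \<le> Suc (card (\<omega> \<inter> K - {p}))"
    by (simp add: card_Diff_singleton_if) linarith
  with n(4) have "n - 1 \<le> card (\<omega> \<inter> K - {p})"
    by linarith
  then obtain F where F: "F \<subseteq> \<omega> \<inter> K - {p}" "card F = n - 1" "finite F"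
    by (rule obtain_subset_with_card_n)
  have "(\<integral>x. f x \<partial>config_measure F) = (\<integral>x. f x \<partial>config_measure (insert p F))" if f: "f \<in> Cc" for f
  proof -
    have cont: "continuous_on UNIV f" and supp: "compact (closure {x. f x \<noteq> 0})"
      using f by (auto simp: Cc_def)
    have sub: "{x. f x \<noteq> 0} \<subseteq> closure {x. f x \<noteq> 0}" by (rule closure_subset)
    show ?thesis
      unfolding integral_config_measure[OF cont supp sub finite_in_configurations[OF F(3)]]
        integral_config_measure[OF cont supp sub finite_in_configurations[OF finite.insertI[OF F(3)]]]
      using F(3) Cc_vanishes[OF f p(2)] by (intro sum.mono_neutral_left) auto
  qed
  then have "F \<in> ?E \<longleftrightarrow> insert p F \<in> ?E"
    using F(3) by (intro sets_configuration_space_saturated meas finite_in_configurations) auto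
  moreover have "F \<inter> K = F" "insert p F \<inter> K = insert p F" "card (insert p F) = n"
    using F p(1) n(1) by (auto simp: card_insert_if)
  ultimately show False
    using F n finite_in_configurations[of F] finite_in_configurations[of "insert p F"] by auto
qed

section \<open>Approximation of a compact set by test functions\<close>

definition bump :: "'a::metric_space set \<Rightarrow> real \<Rightarrow> 'a \<Rightarrow> real" where
  "bump K c x = max 0 (1 - c * infdist x K)"

lemma continuous_bump: "continuous_on A (bump K c)"
  unfolding bump_def by (intro continuous_intros)

lemma bump_le_1: "c \<ge> 0 \<Longrightarrow> bump K c x \<le> 1"
  by (simp add: bump_def infdist_nonneg)

lemma bump_nonneg: "bump K c x \<ge> 0"
  by (simp add: bump_def)

text \<open>The set is nonempty because \<open>infdist x {} = 0\<close> by convention, which makes the bump of the empty set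
  constantly 1.\<close>

lemma bump_tendsto_indicator:
  assumes "closed K" "K \<noteq> {}"
  shows "(\<lambda>k. bump K (c + real k) x) \<longlonglongrightarrow> indicator K x"
proof (cases "x \<in> K")
  case True
  then show ?thesis by (simp add: bump_def)
next
  case False
  then have d: "infdist x K > 0"
    using assms in_closed_iff_infdist_zero infdist_nonneg[of x K] by (metis less_eq_real_def)
  have "\<forall>\<^sub>F k in sequentially. bump K (c + real k) x = 0"
  proof -
    have "filterlim (\<lambda>k. (c + real k) * infdist x K) at_top sequentially"
      using d by real_asymp
    then have "\<forall>\<^sub>F k in sequentially. (c + real k) * infdist x K \<ge> 1"
      by (auto simp: filterlim_at_top)
    then show ?thesis by eventually_elim (simp add: bump_def)
  qed
  then show ?thesis using False by (simp add: tendsto_eventually)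
qed

lemma compact_neighbourhood_of_compact:
  fixes K :: "'a::metric_space set"
  assumes K: "compact K" and loc: "\<And>x. x \<in> K \<Longrightarrow> \<exists>V. compact V \<and> x \<in> interior V"
  obtains V where "compact V" "K \<subseteq> interior V"
proof -
  obtain V where V: "\<And>x. x \<in> K \<Longrightarrow> compact (V x) \<and> x \<in> interior (V x)"
    using loc by metis
  obtain C where C: "C \<subseteq> K" "finite C" "K \<subseteq> (\<Union>x\<in>C. interior (V x))"
    using compactE_image[OF K, of K "\<lambda>x. interior (V x)"] V by blast
  show ?thesis
  proof
    show "compact (\<Union>x\<in>C. V x)" using C V by (intro compact_UN) auto
    have "(\<Union>x\<in>C. interior (V x)) \<subseteq> interior (\<Union>x\<in>C. V x)"
      by (intro UN_least interior_mono) auto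
    with C(3) show "K \<subseteq> interior (\<Union>x\<in>C. V x)" by blast
  qed
qed

lemma bump_support:
  fixes K :: "'a::metric_space set"
  assumes K: "compact K" "K \<noteq> {}" and V: "K \<subseteq> interior V"
  obtains c where "c > 0" "\<And>d. d \<ge> c \<Longrightarrow> {x. bump K d x \<noteq> 0} \<subseteq> V"
proof -
  obtain e where e: "e > 0" "(\<Union>x\<in>K. ball x e) \<subseteq> interior V"
    using compact_subset_open_imp_ball_epsilon_subset[OF K(1) open_interior V] by blast
  show ?thesis
  proof
    show "1 / e > 0" using e by simp
    fix d assume d: "d \<ge> 1 / e"
    show "{x. bump K d x \<noteq> 0} \<subseteq> V"
    proof
      fix x assume "x \<in> {x. bump K d x \<noteq> 0}"
      then have "d * infdist x K < 1" by (simp add: bump_def max_def split: if_splits)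
      moreover have "1 / e * infdist x K \<le> d * infdist x K"
        using d by (intro mult_right_mono infdist_nonneg)
      ultimately have "1 / e * infdist x K < 1" by linarith
      then have "infdist x K < e" using e(1) by (simp add: field_simps)
      then obtain y where "y \<in> K" "dist x y < e"
        using cInf_lessD[of "dist x ` K" e] K(2) by (auto simp: infdist_notempty)
      then have "x \<in> (\<Union>y\<in>K. ball y e)" by (auto simp: dist_commute)
      then show "x \<in> V" using e(2) interior_subset by blast
    qed
  qed
qed

section \<open>The law of the number of points in a compact set\<close>

lemma integral_config_measure_measurable:
  assumes \<mu>: "space \<mu> = configurations" "sets \<mu> = sets configuration_space" and f: "f \<in> Cc"
  shows "(\<lambda>\<omega>. \<integral>x. f x \<partial>config_measure \<omega>) \<in> borel_measurable \<mu>"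
proof (rule borel_measurableI)
  fix S :: "real set" assume S: "open S"
  have "openin vague_topology {\<omega> \<in> configurations. (\<integral>x. f x \<partial>config_measure \<omega>) \<in> S}"
    unfolding vague_topology_def using f S by (intro topology_generated_by_Basis) auto
  then have "{\<omega> \<in> configurations. (\<integral>x. f x \<partial>config_measure \<omega>) \<in> S} \<in> sets \<mu>"
    by (simp add: \<mu> sets_configuration_space sigma_sets.Basic)
  also have "{\<omega> \<in> configurations. (\<integral>x. f x \<partial>config_measure \<omega>) \<in> S}
      = (\<lambda>\<omega>. \<integral>x. f x \<partial>config_measure \<omega>) -` S \<inter> space \<mu>"
    by (auto simp: \<mu>)
  finally show "(\<lambda>\<omega>. \<integral>x. f x \<partial>config_measure \<omega>) -` S \<inter> space \<mu> \<in> sets \<mu>" .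
qed

text \<open>On a compact set with a compact neighbourhood, the indicator of \<open>K\<close> is the pointwise limit of bumps
  that lie in \<open>Cc\<close> and are all supported in the one compact set \<open>V\<close>. Measurability of the count passes to
  the limit because a configuration meets \<open>V\<close> in finitely many points. So does the Laplace
  functional: for \<open>t < 0\<close> the left-hand integrands are bounded by 1, and the
  right-hand ones by the indicator of \<open>V\<close>.\<close>

lemma poisson_measure_count:
  fixes \<sigma> :: "'a::metric_space measure"
  assumes \<sigma>: "radon_measure \<sigma>" and \<mu>: "poisson_measure \<sigma> \<mu>"
    and K: "compact K" "K \<noteq> {}" and V: "compact V" "K \<subseteq> interior V"
  shows "(\<lambda>\<omega>. card (\<omega> \<inter> K)) \<in> measurable \<mu> (count_space UNIV)"
    and "t < 0 \<Longrightarrow> (\<integral>\<omega>. exp (t * real (card (\<omega> \<inter> K))) \<partial>\<mu>) = exp ((exp t - 1) * measure \<sigma> K)"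
proof -
  obtain c where c: "c > 0" "\<And>d. d \<ge> c \<Longrightarrow> {x. bump K d x \<noteq> 0} \<subseteq> V"
    using bump_support[OF K V(2)] by blast
  define f where "f = (\<lambda>k. bump K (c + real k))"
  have f_cont: "continuous_on UNIV (f k)" for k
    unfolding f_def by (rule continuous_bump)
  have f_supp: "{x. f k x \<noteq> 0} \<subseteq> V" for k
    unfolding f_def by (rule c(2)) simp
  have f_bounds: "0 \<le> f k x" "f k x \<le> 1" for k x
    using c(1) by (simp_all add: f_def bump_nonneg bump_le_1)
  have f_lim: "(\<lambda>k. f k x) \<longlonglongrightarrow> indicator K x" for x
    unfolding f_def using K by (intro bump_tendsto_indicator compact_imp_closed)
  have tf_Cc: "(\<lambda>x. t * f k x) \<in> Cc" for t k
  proof -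
    have "{x. t * f k x \<noteq> 0} \<subseteq> V" using f_supp[of k] by auto
    then have "closure {x. t * f k x \<noteq> 0} \<subseteq> V"
      using V(1) by (intro closure_minimal compact_imp_closed)
    then have "compact (closure {x. t * f k x \<noteq> 0})"
      using V(1) by (metis closed_closure compact_Int_closed inf.absorb_iff2)
    then show ?thesis
      using f_cont by (auto simp: Cc_def intro!: continuous_intros)
  qed
  interpret \<mu>: prob_space \<mu> using \<mu> by (simp add: poisson_measure_def)
  have space: "space \<mu> = configurations" and sets: "sets \<mu> = sets configuration_space"
    and laplace: "\<And>g. g \<in> Cc \<Longrightarrow> (\<integral>\<omega>. exp (\<integral>x. g x \<partial>config_measure \<omega>) \<partial>\<mu>) = exp (\<integral>x. (exp (g x) - 1) \<partial>\<sigma>)"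
    using \<mu> by (auto simp: poisson_measure_def has_bochner_integral_iff)
  have meas: "(\<lambda>\<omega>. \<integral>x. t * f k x \<partial>config_measure \<omega>) \<in> borel_measurable \<mu>" for t k
    by (intro integral_config_measure_measurable space sets tf_Cc)
  have sum: "(\<integral>x. t * f k x \<partial>config_measure \<omega>) = (\<Sum>x\<in>\<omega> \<inter> V. t * f k x)"
    if "\<omega> \<in> configurations" for \<omega> t k
    using f_cont f_supp[of k] that by (intro integral_config_measure V(1)) (auto intro!: continuous_intros)
  have lim: "(\<lambda>k. \<integral>x. t * f k x \<partial>config_measure \<omega>) \<longlonglongrightarrow> t * real (card (\<omega> \<inter> K))"
    if \<omega>: "\<omega> \<in> configurations" for \<omega> t
  proof -
    have "finite (\<omega> \<inter> V)" using \<omega> V(1) by (simp add: configurations_def)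
    moreover have "\<omega> \<inter> V \<inter> K = \<omega> \<inter> K" using V(2) interior_subset[of V] by blast
    ultimately have "(\<Sum>x\<in>\<omega> \<inter> V. t * indicator K x) = t * real (card (\<omega> \<inter> K))"
      using sum.inter_restrict[of "\<omega> \<inter> V" "\<lambda>_. 1::real" K]
      by (simp add: indicator_def of_bool_def flip: sum_distrib_left)
    moreover have "(\<lambda>k. \<Sum>x\<in>\<omega> \<inter> V. t * f k x) \<longlonglongrightarrow> (\<Sum>x\<in>\<omega> \<inter> V. t * indicator K x)"
      by (intro tendsto_intros f_lim)
    ultimately show ?thesis unfolding sum[OF \<omega>] by simp
  qed
  have "(\<lambda>\<omega>. 1 * real (card (\<omega> \<inter> K))) \<in> borel_measurable \<mu>"
    by (rule borel_measurable_LIMSEQ_real[OF lim meas]) (simp add: space)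
  then have count_meas: "(\<lambda>\<omega>. real (card (\<omega> \<inter> K))) \<in> borel_measurable \<mu>" by simp
  show "(\<lambda>\<omega>. card (\<omega> \<inter> K)) \<in> measurable \<mu> (count_space UNIV)"
  proof -
    have "(\<lambda>\<omega>. nat \<lfloor>real (card (\<omega> \<inter> K))\<rfloor>) \<in> measurable \<mu> (count_space UNIV)"
      using count_meas by measurable
    then show ?thesis by simp
  qed
  assume t: "t < 0"
  have "(\<lambda>k. \<integral>\<omega>. exp (\<integral>x. t * f k x \<partial>config_measure \<omega>) \<partial>\<mu>)
      \<longlonglongrightarrow> (\<integral>\<omega>. exp (t * real (card (\<omega> \<inter> K))) \<partial>\<mu>)"
  proof (rule integral_dominated_convergence[where w = "\<lambda>_. 1"])
    show "AE \<omega> in \<mu>. norm (exp (\<integral>x. t * f k x \<partial>config_measure \<omega>)) \<le> 1" for k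
    proof (rule AE_I2)
      fix \<omega> assume "\<omega> \<in> space \<mu>"
      then have "(\<integral>x. t * f k x \<partial>config_measure \<omega>) \<le> 0"
        using t f_bounds(1)[of k]
        by (simp add: space sum sum_nonpos mult_nonpos_nonneg)
      then show "norm (exp (\<integral>x. t * f k x \<partial>config_measure \<omega>)) \<le> 1" by simp
    qed
  qed (use meas count_meas lim in \<open>auto simp: space intro!: AE_I2 tendsto_exp\<close>)
  moreover have "(\<lambda>k. \<integral>\<omega>. exp (\<integral>x. t * f k x \<partial>config_measure \<omega>) \<partial>\<mu>)
      \<longlonglongrightarrow> exp ((exp t - 1) * measure \<sigma> K)"
  proof -
    have sets_\<sigma>: "sets \<sigma> = sets borel" using \<sigma> by (simp add: radon_measure_def)
    have fin: "emeasure \<sigma> C < \<infinity>" if "compact C" for C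
      using \<sigma> that by (simp add: radon_measure_def)
    have [measurable]: "f k \<in> borel_measurable \<sigma>" for k
      using borel_measurable_continuous_onI[OF f_cont] by (simp add: measurable_cong_sets[OF sets_\<sigma> refl])
    have [measurable]: "K \<in> sets \<sigma>" "V \<in> sets \<sigma>"
      using K V by (auto simp: sets_\<sigma> borel_compact)
    have "(\<lambda>k. \<integral>x. (exp (t * f k x) - 1) \<partial>\<sigma>) \<longlonglongrightarrow> (\<integral>x. (exp t - 1) * indicator K x \<partial>\<sigma>)"
    proof (rule integral_dominated_convergence[where w = "indicator V"])
      show "integrable \<sigma> (indicator V :: 'a \<Rightarrow> real)"
        using fin[OF V(1)] by (intro integrable_real_indicator) auto
      have "(\<lambda>k. exp (t * f k x) - 1) \<longlonglongrightarrow> exp (t * indicator K x) - 1" for x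
        by (intro tendsto_intros f_lim)
      moreover have "exp (t * indicator K x) - 1 = (exp t - 1) * indicator K x" for x
        by (simp add: indicator_def)
      ultimately show "AE x in \<sigma>. (\<lambda>k. exp (t * f k x) - 1) \<longlonglongrightarrow> (exp t - 1) * indicator K x"
        by simp
      show "AE x in \<sigma>. norm (exp (t * f k x) - 1) \<le> indicator V x" for k
      proof (rule AE_I2)
        fix x
        have "t * f k x \<le> 0" using t f_bounds(1)[of k x] by (simp add: mult_nonpos_nonneg)
        then have "\<bar>exp (t * f k x) - 1\<bar> \<le> 1" by (simp add: abs_if)
        moreover have "f k x = 0" if "x \<notin> V" using f_supp[of k] that by blast
        ultimately show "norm (exp (t * f k x) - 1) \<le> indicator V x"
          by (cases "x \<in> V") auto
      qed
    qed measurable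
    also have "(\<integral>x. (exp t - 1) * indicator K x \<partial>\<sigma>) = (exp t - 1) * measure \<sigma> K"
      using sets.sets_into_space[of K \<sigma>] by (simp add: Int_absorb2)
    finally show ?thesis
      unfolding laplace[OF tf_Cc] by (rule tendsto_exp)
  qed
  ultimately show "(\<integral>\<omega>. exp (t * real (card (\<omega> \<inter> K))) \<partial>\<mu>) = exp ((exp t - 1) * measure \<sigma> K)"
    by (rule LIMSEQ_unique)
qed

section \<open>The deviation bound\<close>

lemma upper_int_props:
  assumes "R > 0"
  shows "upper_int R \<ge> 1" "real (upper_int R) \<ge> R" "R \<le> real k \<longleftrightarrow> upper_int R \<le> k"
proof -
  have ne: "{N::nat. N \<ge> 1 \<and> real N \<ge> R} \<noteq> {}"
    using real_arch_simple[of "max 1 R"] by auto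
  show 1: "upper_int R \<ge> 1" "real (upper_int R) \<ge> R"
    using Inf_nat_def1[OF ne] by (auto simp: upper_int_def)
  show "R \<le> real k \<longleftrightarrow> upper_int R \<le> k"
  proof
    assume "R \<le> real k"
    moreover from this assms have "k \<ge> 1" by (cases k) auto
    ultimately show "upper_int R \<le> k" unfolding upper_int_def by (intro wellorder_Inf_le1) auto
  next
    assume "upper_int R \<le> k"
    with 1(2) show "R \<le> real k" by linarith
  qed
qed

lemma poisson_tail_bound_nonneg: "r > 0 \<Longrightarrow> poisson_tail_bound s r \<ge> 0"
  by (simp add: poisson_tail_bound_def Let_def)

theorem proposition4p5:
  fixes \<sigma> :: "'a::metric_space measure" and \<mu> :: "'a set measure"
    and K :: "'a set" and r :: real
  assumes "sigma_compact (UNIV :: 'a set)"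
    and "radon_measure \<sigma>"
    and "diffuse_measure \<sigma>"
    and "poisson_measure \<sigma> \<mu>"
    and "compact K"
    and "r > 0"
  shows "measure \<mu> {\<omega> \<in> configurations. measure (config_measure \<omega>) K \<ge> measure \<sigma> K + r}
         \<le> poisson_tail_bound (measure \<sigma> K) r"
proof -
  define s where "s = measure \<sigma> K"
  define E where "E = {\<omega> \<in> configurations. real (card (\<omega> \<inter> K)) \<ge> s + r}"
  have s: "s \<ge> 0" by (simp add: s_def)
  have E_eq: "{\<omega> \<in> configurations. measure (config_measure \<omega>) K \<ge> measure \<sigma> K + r} = E"
    using measure_config_measure_compact[OF _ assms(5)] by (auto simp: E_def s_def)
  have "measure \<mu> E \<le> poisson_tail_bound s r"
  proof (cases "K = {} \<or> (\<exists>p\<in>K. \<nexists>V. compact V \<and> p \<in> interior V)")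
    case True
    have sets: "sets \<mu> = sets configuration_space"
      using assms(4) by (simp add: poisson_measure_def)
    \<comment> \<open>A non-measurable set has measure 0 by convention, so both alternatives give the bound.\<close>
    have "E = {} \<or> E \<notin> sets \<mu>"
    proof (cases "K = {}")
      case True
      then show ?thesis using s assms(6) by (auto simp: E_def)
    next
      case False
      with True show ?thesis
        unfolding E_def sets
        using counting_event_not_measurable[OF assms(5), of _ "s + r"] s assms(6) by auto
    qed
    then have "measure \<mu> E = 0" by (auto simp: measure_notin_sets)
    then show ?thesis using poisson_tail_bound_nonneg[OF assms(6)] by simp
  next
    case False
    then obtain V where V: "compact V" "K \<subseteq> interior V"
      using compact_neighbourhood_of_compact[OF assms(5)] by blast
    interpret prob_space \<mu> using assms(4) by (simp add: poisson_measure_def)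
    have space: "space \<mu> = configurations" using assms(4) by (simp add: poisson_measure_def)
    from False have "K \<noteq> {}" by simp
    note count = poisson_measure_count[OF assms(2,4,5) this V]
    define n where "n = upper_int (s + r)"
    have n: "n \<ge> 1" "s + r \<le> real n" "\<And>k. s + r \<le> real k \<longleftrightarrow> n \<le> k"
      using upper_int_props[of "s + r"] s assms(6) by (auto simp: n_def)
    have law: "prob {\<omega> \<in> space \<mu>. card (\<omega> \<inter> K) = j} = s ^ j / fact j * exp (-s)" for j
      by (rule poisson_distribution_of_laplace[OF count(1)]) (simp add: count(2) s_def)
    have E_sets: "E \<in> sets \<mu>"
    proof -
      have "E = (\<lambda>\<omega>. card (\<omega> \<inter> K)) -` {n..} \<inter> space \<mu>"
        by (auto simp: E_def n(3) space)
      then show ?thesis using measurable_sets[OF count(1), of "{n..}"] by simp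
    qed
    have "(\<lambda>j. prob {\<omega> \<in> space \<mu>. card (\<omega> \<inter> K) = j} * of_bool (n \<le> j))
        sums expectation (\<lambda>\<omega>. of_bool (n \<le> card (\<omega> \<inter> K)))"
      by (rule expectation_nat_sums[OF count(1), where B = 1]) simp
    also have "expectation (\<lambda>\<omega>. of_bool (n \<le> card (\<omega> \<inter> K))) = expectation (indicator E)"
      by (intro Bochner_Integration.integral_cong) (auto simp: E_def n(3) space indicator_def)
    also have "\<dots> = measure \<mu> E"
      using E_sets sets.sets_into_space[OF E_sets] by (simp add: Int_absorb2)
    finally have tail: "(\<lambda>j. s ^ j / fact j * exp (-s) * of_bool (n \<le> j)) sums measure \<mu> E"
      unfolding law .
    show ?thesis
    proof (cases "s = 0")
      case True
      have "(\<lambda>j. s ^ j / fact j * exp (-s) * of_bool (n \<le> j)) = (\<lambda>_. 0)"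
        using n(1) True by (auto simp: fun_eq_iff power_0_left)
      with tail have "measure \<mu> E = 0" by (simp add: sums_iff)
      then show ?thesis by (simp add: True poisson_tail_bound_def)
    next
      case False
      with s have "s > 0" by simp
      then show ?thesis
        using poisson_tail_sum_le[OF _ assms(6) n(2) tail] False
        by (simp add: poisson_tail_bound_def n_def Let_def)
    qed
  qed
  then show ?thesis unfolding E_eq s_def .
qed

end
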